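(* Let $C$ be an $\Omega$-space and let $C^\delta$ be its canonical extension with respect to $F\subseteq\mathcal UC$ and $I\subseteq\mathcal DC$. Then every $\kappa\in C^\delta$ is a weighted colimit of limits of $C$ and a weighted limit of colimits of $C$. That is, for every $\kappa\in C^\delta$: (1) there are an $\Omega$-space $Y$, a functor $H:Y\to C^\delta$ and a weight $\phi\in\mathcal DY$ such that $\kappa=\mathrm{colim}_\phi H$ and for every $y\in Y$ there is $f\in F$ with $H(y)=\lim_f[-]$; (2) there are an $\Omega$-space $Z$, a functor $K:Z\to C^\delta$ and a weight $\psi\in\mathcal UZ$ such that $\kappa=\lim_\psi K$ and for every $z\in Z$ there is $i\in I$ with $K(z)=\mathrm{colim}_i[-]$. Here $\lim_f[-]$ and $\mathrm{colim}_i[-]$ are the weighted limit and colimit of $[-]:C\to C^\delta$.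
   Context: Quantale: $\Omega=(\Omega,\sqsubseteq,\bigsqcup,e,\cdot)$ is a complete lattice (joins $\bigsqcup$, meets $\bigwedge$) with a monoid structure $(e,\cdot)$, not necessarily commutative, whose multiplication preserves arbitrary joins in each argument. Residuals $\rhd,\lhd$ are defined by $b\sqsubseteq a\rhd c\Leftrightarrow a\cdot b\sqsubseteq c\Leftrightarrow a\sqsubseteq c\lhd b$. $\Omega$-space: a set $X$ with $X(-,-):X\times X\to\Omega$ such that $e\sqsubseteq X(x,x)$ and $X(x,y)\cdot X(y,z)\sqsubseteq X(x,z)$. A functor $G:X\to Y$ is a map with $X(x,x')\sqsubseteq Y(Gx,Gx')$. $\mathcal DX$ (weighted downsets, presheaves): functions $\phi:X\to\Omega$ with $X(x',x)\cdot\phi(x)\sqsubseteq\phi(x')$. $\mathcal UX$ (weighted upsets, co-presheaves): functions $\psi:X\to\Omega$ with $\psi(x)\cdot X(x,x')\sqsubseteq\psi(x')$. Weighted (co)limits: for a functor $G:X\to B$, the colimit of $G$ weighted by $\phi\in\mathcal DX$ is an element $\mathrm{colim}_\phi G\in B$ with $B(\mathrm{colim}_\phi G,b)=\bigwedge_{x}\phi(x)\rhd B(Gx,b)$ for all $b\in B$; the limit weighted by $\psi\in\mathcal UX$ is an element $\lim_\psi G\in B$ with $B(b,\lim_\psi G)=\bigwedge_x B(b,Gx)\lhd\psi(x)$ for all $b\in B$. Canonical extension: let $F\subseteq\mathcal UC$ and $I\subseteq\mathcal DC$ be subsets which (standing assumption) contain all representables, i.e. $C(c,-)\in F$ and $C(-,c)\in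 I$ for all $c\in C$. Put $\mathbf I(f,i)=\bigsqcup_{c}f(c)\cdot i(c)$ for $f\in F,i\in I$. The elements of $C^\delta$ are pairs $\kappa=(\phi_\kappa,\psi_\kappa)$ of functions $\phi_\kappa:F\to\Omega$, $\psi_\kappa:I\to\Omega$ with $\psi_\kappa(i)=\bigwedge_{f\in F}\phi_\kappa(f)\rhd\mathbf I(f,i)$ and $\phi_\kappa(f)=\bigwedge_{i\in I}\mathbf I(f,i)\lhd\psi_\kappa(i)$. The hom is $C^\delta(\kappa,\kappa')=\bigwedge_{f}\phi_\kappa(f)\rhd\phi_{\kappa'}(f)=\bigwedge_i\psi_\kappa(i)\lhd\psi_{\kappa'}(i)$ (the two expressions agree). $C^\delta$ has all weighted limits and colimits, and weighted (co)limits in it are unique. The functor $[-]:C\to C^\delta$ is given by $\phi_{[c]}(f)=f(c)$, $\psi_{[c]}(i)=i(c)$. *)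

theory Defs
  imports "HOL-Library.FuncSet"
begin

text \<open>
  Unital quantales, not necessarily commutative: the order is \<open>\<le>\<close>, the unit is \<open>1\<close> and the
  multiplication is \<open>*\<close>.
\<close>

class quantale = complete_lattice + monoid_mult +
  assumes Sup_mult: "Sup A * b = (SUP a\<in>A. a * b)"
    and mult_Sup: "a * Sup B = (SUP b\<in>B. a * b)"

definition rres :: "'q::quantale \<Rightarrow> 'q \<Rightarrow> 'q" (infix "\<rhd>" 60)
  where "a \<rhd> c = Sup {b. a * b \<le> c}"

definition lres :: "'q::quantale \<Rightarrow> 'q \<Rightarrow> 'q" (infix "\<lhd>" 60)
  where "c \<lhd> b = Sup {a. a * b \<le> c}"

lemma quantale_mult_mono:
  fixes a b c d :: "'q::quantale"
  assumes "a \<le> b" "c \<le> d"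
  shows "a * c \<le> b * d"
proof -
  have "b * c = sup (a * c) (b * c)"
    using Sup_mult[of "{a, b}" c] assms(1) by (simp add: sup_absorb2)
  moreover have "b * d = sup (b * c) (b * d)"
    using mult_Sup[of b "{c, d}"] assms(2) by (simp add: sup_absorb2)
  ultimately show ?thesis
    by (metis sup.cobounded1 order_trans)
qed

lemma le_rres_iff: "b \<le> a \<rhd> c \<longleftrightarrow> a * b \<le> (c::'q::quantale)"
proof
  assume "b \<le> a \<rhd> c"
  then have "a * b \<le> a * (a \<rhd> c)"
    by (simp add: quantale_mult_mono)
  also have "\<dots> \<le> c"
    unfolding rres_def mult_Sup by (rule SUP_least) simp
  finally show "a * b \<le> c" .
qed (simp add: rres_def Sup_upper)

lemma le_lres_iff: "a \<le> c \<lhd> b \<longleftrightarrow> a * b \<le> (c::'q::quantale)"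
proof
  assume "a \<le> c \<lhd> b"
  then have "a * b \<le> (c \<lhd> b) * b"
    by (simp add: quantale_mult_mono)
  also have "\<dots> \<le> c"
    unfolding lres_def Sup_mult by (rule SUP_least) simp
  finally show "a * b \<le> c" .
qed (simp add: lres_def Sup_upper)

text \<open>
  Spaces have an explicit carrier \<open>pts\<close>, which may be empty; the values of \<open>hom\<close> outside the
  carrier are irrelevant.
\<close>

record ('x, 'q) qspace =
  pts :: "'x set"
  hom :: "'x \<Rightarrow> 'x \<Rightarrow> 'q"

definition omega_space :: "('x, 'q::quantale) qspace \<Rightarrow> bool"
  where "omega_space X \<longleftrightarrow>
    (\<forall>x\<in>pts X. 1 \<le> hom X x x) \<and>
    (\<forall>x\<in>pts X. \<forall>y\<in>pts X. \<forall>z\<in>pts X. hom X x y * hom X y z \<le> hom X x z)"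

definition omega_functor ::
    "('x, 'q::quantale) qspace \<Rightarrow> ('y, 'q) qspace \<Rightarrow> ('x \<Rightarrow> 'y) \<Rightarrow> bool"
  where "omega_functor X Y G \<longleftrightarrow>
    G \<in> pts X \<rightarrow> pts Y \<and>
    (\<forall>x\<in>pts X. \<forall>x'\<in>pts X. hom X x x' \<le> hom Y (G x) (G x'))"

text \<open>
  Functions on a carrier are represented by extensional functions, so that HOL equality of weights
  is equality of functions on the carrier.
\<close>

definition downsets :: "('x, 'q::quantale) qspace \<Rightarrow> ('x \<Rightarrow> 'q) set"
  where "downsets X =
    {\<phi> \<in> extensional (pts X). \<forall>x\<in>pts X. \<forall>x'\<in>pts X. hom X x' x * \<phi> x \<le> \<phi> x'}"

definition upsets :: "('x, 'q::quantale) qspace \<Rightarrow> ('x \<Rightarrow> 'q) set"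
  where "upsets X =
    {\<psi> \<in> extensional (pts X). \<forall>x\<in>pts X. \<forall>x'\<in>pts X. \<psi> x * hom X x x' \<le> \<psi> x'}"

text \<open>
  \<open>is_colim B X \<phi> G k\<close> says that \<open>k\<close> is a colimit in \<open>B\<close> of \<open>G : X \<rightarrow> B\<close> weighted by \<open>\<phi>\<close>, and
  dually for \<open>is_lim\<close>. In a general \<open>B\<close> these determine \<open>k\<close> only up to isomorphism.
\<close>

definition is_colim ::
    "('b, 'q::quantale) qspace \<Rightarrow> ('x, 'q) qspace \<Rightarrow> ('x \<Rightarrow> 'q) \<Rightarrow> ('x \<Rightarrow> 'b) \<Rightarrow> 'b \<Rightarrow> bool"
  where "is_colim B X \<phi> G k \<longleftrightarrow>
    k \<in> pts B \<and> (\<forall>b\<in>pts B. hom B k b = (INF x\<in>pts X. \<phi> x \<rhd> hom B (G x) b))"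

definition is_lim ::
    "('b, 'q::quantale) qspace \<Rightarrow> ('x, 'q) qspace \<Rightarrow> ('x \<Rightarrow> 'q) \<Rightarrow> ('x \<Rightarrow> 'b) \<Rightarrow> 'b \<Rightarrow> bool"
  where "is_lim B X \<psi> G k \<longleftrightarrow>
    k \<in> pts B \<and> (\<forall>b\<in>pts B. hom B b k = (INF x\<in>pts X. hom B b (G x) \<lhd> \<psi> x))"

definition pairing :: "('c, 'q::quantale) qspace \<Rightarrow> ('c \<Rightarrow> 'q) \<Rightarrow> ('c \<Rightarrow> 'q) \<Rightarrow> 'q"
  where "pairing C f i = (SUP c\<in>pts C. f c * i c)"

type_synonym ('c, 'q) cut = "(('c \<Rightarrow> 'q) \<Rightarrow> 'q) \<times> (('c \<Rightarrow> 'q) \<Rightarrow> 'q)"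

definition canonical_extension ::
    "('c, 'q::quantale) qspace \<Rightarrow> ('c \<Rightarrow> 'q) set \<Rightarrow> ('c \<Rightarrow> 'q) set \<Rightarrow> (('c, 'q) cut, 'q) qspace"
  where "canonical_extension C F I =
    \<lparr> pts = {\<kappa>. fst \<kappa> \<in> extensional F \<and> snd \<kappa> \<in> extensional I \<and>
              (\<forall>i\<in>I. snd \<kappa> i = (INF f\<in>F. fst \<kappa> f \<rhd> pairing C f i)) \<and>
              (\<forall>f\<in>F. fst \<kappa> f = (INF i\<in>I. pairing C f i \<lhd> snd \<kappa> i))},
      hom = (\<lambda>\<kappa> \<kappa>'. INF f\<in>F. fst \<kappa> f \<rhd> fst \<kappa>' f) \<rparr>"

definition embedding ::
    "('c \<Rightarrow> 'q) set \<Rightarrow> ('c \<Rightarrow> 'q) set \<Rightarrow> 'c \<Rightarrow> ('c, 'q::quantale) cut"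
  where "embedding F I c = ((\<lambda>f\<in>F. f c), (\<lambda>i\<in>I. i c))"

lemma le_snd_canonical_extension_iff:
  assumes "\<kappa> \<in> pts (canonical_extension C F I)" "i \<in> I"
  shows "b \<le> snd \<kappa> i \<longleftrightarrow> (\<forall>f\<in>F. fst \<kappa> f * b \<le> pairing C f i)"
proof -
  have "snd \<kappa> i = (INF f\<in>F. fst \<kappa> f \<rhd> pairing C f i)"
    using assms unfolding canonical_extension_def by simp
  then show ?thesis
    by (simp only: le_INF_iff le_rres_iff)
qed

lemma le_fst_canonical_extension_iff:
  assumes "\<kappa> \<in> pts (canonical_extension C F I)" "f \<in> F"
  shows "a \<le> fst \<kappa> f \<longleftrightarrow> (\<forall>i\<in>I. a * snd \<kappa> i \<le> pairing C f i)"
proof -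
  have "fst \<kappa> f = (INF i\<in>I. pairing C f i \<lhd> snd \<kappa> i)"
    using assms unfolding canonical_extension_def by simp
  then show ?thesis
    by (simp only: le_INF_iff le_lres_iff)
qed

lemma hom_canonical_extension:
  "hom (canonical_extension C F I) \<kappa> \<kappa>' = (INF f\<in>F. fst \<kappa> f \<rhd> fst \<kappa>' f)"
  by (simp add: canonical_extension_def)

lemma hom_canonical_extension_alt:
  assumes "\<kappa> \<in> pts (canonical_extension C F I)" "\<kappa>' \<in> pts (canonical_extension C F I)"
  shows "hom (canonical_extension C F I) \<kappa> \<kappa>' = (INF i\<in>I. snd \<kappa> i \<lhd> snd \<kappa>' i)"
proof -
  have "a \<le> (INF f\<in>F. fst \<kappa> f \<rhd> fst \<kappa>' f) \<longleftrightarrow> a \<le> (INF i\<in>I. snd \<kappa> i \<lhd> snd \<kappa>' i)" for a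
    unfolding le_INF_iff le_rres_iff le_lres_iff
    using le_fst_canonical_extension_iff[OF assms(2)] le_snd_canonical_extension_iff[OF assms(1)]
    by (auto simp: mult.assoc)
  then show ?thesis
    unfolding hom_canonical_extension by (meson order_antisym order_refl)
qed

lemma canonical_extension_antisym:
  assumes k: "\<kappa> \<in> pts (canonical_extension C F I)" "\<kappa>' \<in> pts (canonical_extension C F I)"
    and le: "1 \<le> hom (canonical_extension C F I) \<kappa> \<kappa>'"
      "1 \<le> hom (canonical_extension C F I) \<kappa>' \<kappa>"
  shows "\<kappa> = \<kappa>'"
proof (rule prod_eqI)
  have ext: "fst \<kappa> \<in> extensional F" "fst \<kappa>' \<in> extensional F"
    "snd \<kappa> \<in> extensional I" "snd \<kappa>' \<in> extensional I"
    using k unfolding canonical_extension_def by simp_all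
  have "fst \<kappa> f = fst \<kappa>' f" if "f \<in> F" for f
    using le that unfolding hom_canonical_extension le_INF_iff le_rres_iff
    by (simp add: order_antisym)
  then show "fst \<kappa> = fst \<kappa>'"
    using ext by (meson extensionalityI)
  have "snd \<kappa> i = snd \<kappa>' i" if "i \<in> I" for i
    using le that
    unfolding hom_canonical_extension_alt[OF k] hom_canonical_extension_alt[OF k(2,1)]
      le_INF_iff le_lres_iff
    by (simp add: order_antisym)
  then show "snd \<kappa> = snd \<kappa>'"
    using ext by (meson extensionalityI)
qed

lemma omega_space_canonical_extension: "omega_space (canonical_extension C F I)"
proof -
  let ?D = "canonical_extension C F I"
  have act: "fst x f * hom ?D x y \<le> fst y f" if "f \<in> F" for x y f
    unfolding le_rres_iff[symmetric] hom_canonical_extension using that by (rule INF_lower)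
  have "hom ?D x y * hom ?D y z \<le> hom ?D x z" for x y z
    unfolding hom_canonical_extension[of _ _ _ x z] le_INF_iff le_rres_iff
  proof
    fix f
    assume f: "f \<in> F"
    have "fst x f * hom ?D x y * hom ?D y z \<le> fst y f * hom ?D y z"
      using act[OF f] by (simp add: quantale_mult_mono)
    also have "\<dots> \<le> fst z f"
      by (rule act[OF f])
    finally show "fst x f * (hom ?D x y * hom ?D y z) \<le> fst z f"
      by (simp add: mult.assoc)
  qed
  moreover have "1 \<le> hom ?D x x" for x
    by (simp add: hom_canonical_extension le_INF_iff le_rres_iff)
  ultimately show ?thesis
    by (simp add: omega_space_def)
qed

lemma is_colim_canonical_extension_unique:
  assumes "is_colim (canonical_extension C F I) X \<phi> G \<kappa>"
    and "is_colim (canonical_extension C F I) X \<phi> G \<kappa>'"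
  shows "\<kappa> = \<kappa>'"
  using assms omega_space_canonical_extension[of C F I]
  by (intro canonical_extension_antisym[of _ C F I]) (auto simp: is_colim_def omega_space_def)

lemma is_lim_canonical_extension_unique:
  assumes "is_lim (canonical_extension C F I) X \<psi> G \<kappa>"
    and "is_lim (canonical_extension C F I) X \<psi> G \<kappa>'"
  shows "\<kappa> = \<kappa>'"
  using assms omega_space_canonical_extension[of C F I]
  by (intro canonical_extension_antisym[of _ C F I]) (auto simp: is_lim_def omega_space_def)

lemma omega_functor_embedding:
  assumes C: "omega_space C"
    and F: "\<And>c. c \<in> pts C \<Longrightarrow> (\<lambda>x\<in>pts C. hom C c x) \<in> F" "F \<subseteq> upsets C"
    and I: "\<And>c. c \<in> pts C \<Longrightarrow> (\<lambda>x\<in>pts C. hom C x c) \<in> I" "I \<subseteq> downsets C"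
  shows "omega_functor C (canonical_extension C F I) (embedding F I)"
proof -
  have up: "f x * hom C x y \<le> f y" if "f \<in> F" "x \<in> pts C" "y \<in> pts C" for f x y
    using that F(2) by (auto simp: upsets_def)
  have down: "hom C x y * i y \<le> i x" if "i \<in> I" "x \<in> pts C" "y \<in> pts C" for i x y
    using that I(2) by (auto simp: downsets_def)
  have refl: "1 \<le> hom C c c" if "c \<in> pts C" for c
    using that C by (auto simp: omega_space_def)
  have ge1: "x \<le> y" if "u * x \<le> y" "1 \<le> u" for x y u :: 'b
    using quantale_mult_mono[of 1 u x x] that by (auto intro: order_trans)
  have ge2: "x \<le> y" if "x * u \<le> y" "1 \<le> u" for x y u :: 'b
    using quantale_mult_mono[of x x 1 u] that by (auto intro: order_trans)
  have le: "f c * i c \<le> pairing C f i" if "c \<in> pts C" for f i c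
    using that by (auto simp: pairing_def intro: SUP_upper)
  have 1: "i c = (INF f\<in>F. f c \<rhd> pairing C f i)" if c: "c \<in> pts C" and i: "i \<in> I" for c i
  proof (rule order_antisym)
    show "i c \<le> (INF f\<in>F. f c \<rhd> pairing C f i)"
      by (auto simp: le_INF_iff le_rres_iff le[OF c])
    let ?f = "\<lambda>x\<in>pts C. hom C c x"
    have "pairing C ?f i \<le> i c"
      unfolding pairing_def using down[OF i c] by (auto intro!: SUP_least)
    moreover have "?f c * (INF f\<in>F. f c \<rhd> pairing C f i) \<le> pairing C ?f i"
      unfolding le_rres_iff[symmetric] by (rule INF_lower[OF F(1)[OF c]])
    ultimately show "(INF f\<in>F. f c \<rhd> pairing C f i) \<le> i c"
      using c refl[OF c] by (auto intro: order_trans ge1[of "?f c"])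
  qed
  have 2: "f c = (INF i\<in>I. pairing C f i \<lhd> i c)" if c: "c \<in> pts C" and f: "f \<in> F" for c f
  proof (rule order_antisym)
    show "f c \<le> (INF i\<in>I. pairing C f i \<lhd> i c)"
      by (auto simp: le_INF_iff le_lres_iff le[OF c])
    let ?i = "\<lambda>x\<in>pts C. hom C x c"
    have "pairing C f ?i \<le> f c"
      unfolding pairing_def using up[OF f _ c] by (auto intro!: SUP_least)
    moreover have "(INF i\<in>I. pairing C f i \<lhd> i c) * ?i c \<le> pairing C f ?i"
      unfolding le_lres_iff[symmetric] by (rule INF_lower[OF I(1)[OF c]])
    ultimately show "(INF i\<in>I. pairing C f i \<lhd> i c) \<le> f c"
      using c refl[OF c] by (auto intro: order_trans ge2[of _ "?i c"])
  qed
  have "embedding F I c \<in> pts (canonical_extension C F I)" if "c \<in> pts C" for c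
    unfolding canonical_extension_def embedding_def
    using 1[OF that, symmetric] 2[OF that, symmetric] by simp
  then show ?thesis
    unfolding omega_functor_def hom_canonical_extension le_INF_iff le_rres_iff
    using up by (simp add: embedding_def)
qed

end

theory Submission
  imports Defs
begin

text \<open>
  Every \<open>f \<in> F\<close> names the cut \<open>L f\<close> whose second component is \<open>pairing C f\<close>, and every \<open>i \<in> I\<close>
  names the cut \<open>R i\<close> whose first component is \<open>\<lambda>f. pairing C f i\<close>. Since \<open>pairing C f i\<close> is a join
  over \<open>c\<close> of \<open>f c * i c\<close>, a map into \<open>L f\<close> is the same as an \<open>f\<close>-weighted family of maps into the
  embedded points; so \<open>L f\<close> is the limit of the embedding weighted by \<open>f\<close>, and dually \<open>R i\<close> is its
  colimit weighted by \<open>i\<close>.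

  These cuts satisfy a Yoneda lemma: the hom from \<open>L f\<close> to \<open>\<kappa>\<close> is \<open>fst \<kappa> f\<close>, and the hom from \<open>\<kappa>\<close>
  to \<open>R i\<close> is \<open>snd \<kappa> i\<close>, because the two equations that define a cut are the two formulas for these
  homs. Consequently the two expressions for the hom of the canonical extension say literally that
  \<open>\<kappa>\<close> is the colimit of \<open>L\<close> weighted by \<open>fst \<kappa>\<close> and the limit of \<open>R\<close> weighted by \<open>snd \<kappa>\<close>. The
  indexing spaces are \<open>F\<close> and \<open>I\<close> with the homs induced by \<open>L\<close> and \<open>R\<close>; the weights are then
  representables restricted along \<open>L\<close> and \<open>R\<close>, hence a downset and an upset.
\<close>

definition induced_space :: "('y, 'q::quantale) qspace \<Rightarrow> 'x set \<Rightarrow> ('x \<Rightarrow> 'y) \<Rightarrow> ('x, 'q) qspace"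
  where "induced_space B A G = \<lparr> pts = A, hom = (\<lambda>x y. hom B (G x) (G y)) \<rparr>"

lemma pts_induced_space [simp]: "pts (induced_space B A G) = A"
  and hom_induced_space [simp]: "hom (induced_space B A G) x y = hom B (G x) (G y)"
  by (simp_all add: induced_space_def)

lemma omega_space_induced:
  assumes "omega_space B" "G \<in> A \<rightarrow> pts B"
  shows "omega_space (induced_space B A G)"
  using assms by (auto simp: omega_space_def Pi_iff)

lemma omega_functor_induced:
  assumes "G \<in> A \<rightarrow> pts B"
  shows "omega_functor (induced_space B A G) B G"
  using assms by (simp add: omega_functor_def)

lemma representable_downset_induced:
  assumes "omega_space B" "G \<in> A \<rightarrow> pts B" "b \<in> pts B" "\<phi> \<in> extensional A"
    and "\<And>x. x \<in> A \<Longrightarrow> \<phi> x = hom B (G x) b"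
  shows "\<phi> \<in> downsets (induced_space B A G)"
  using assms by (simp add: downsets_def omega_space_def Pi_iff)

lemma representable_upset_induced:
  assumes "omega_space B" "G \<in> A \<rightarrow> pts B" "b \<in> pts B" "\<psi> \<in> extensional A"
    and "\<And>x. x \<in> A \<Longrightarrow> \<psi> x = hom B b (G x)"
  shows "\<psi> \<in> upsets (induced_space B A G)"
  using assms by (simp add: upsets_def omega_space_def Pi_iff)

lemma pairing_mult_le_iff:
  "pairing C f i * x \<le> y \<longleftrightarrow> (\<forall>c\<in>pts C. f c * i c * x \<le> (y::'q::quantale))"
  by (simp add: pairing_def le_lres_iff[symmetric] SUP_le_iff)

lemma mult_pairing_le_iff:
  "x * pairing C f i \<le> y \<longleftrightarrow> (\<forall>c\<in>pts C. x * (f c * i c) \<le> (y::'q::quantale))"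
  by (simp add: pairing_def le_rres_iff[symmetric] SUP_le_iff)

definition upset_cut ::
    "('c, 'q::quantale) qspace \<Rightarrow> ('c \<Rightarrow> 'q) set \<Rightarrow> ('c \<Rightarrow> 'q) set \<Rightarrow> ('c \<Rightarrow> 'q) \<Rightarrow> ('c, 'q) cut"
  where "upset_cut C F I f =
    ((\<lambda>g\<in>F. INF i\<in>I. pairing C g i \<lhd> pairing C f i), (\<lambda>i\<in>I. pairing C f i))"

definition downset_cut ::
    "('c, 'q::quantale) qspace \<Rightarrow> ('c \<Rightarrow> 'q) set \<Rightarrow> ('c \<Rightarrow> 'q) set \<Rightarrow> ('c \<Rightarrow> 'q) \<Rightarrow> ('c, 'q) cut"
  where "downset_cut C F I i =
    ((\<lambda>f\<in>F. pairing C f i), (\<lambda>j\<in>I. INF f\<in>F. pairing C f i \<rhd> pairing C f j))"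

text \<open>
  The first component of \<open>upset_cut C F I f\<close> is computed from the second. Recomputing the second
  from the first could only enlarge it, and the value of the first at \<open>f\<close> itself prevents this:
  it is at least the unit, so the meet over \<open>F\<close> is already bounded by its term at \<open>f\<close>.
\<close>

lemma upset_cut_in_canonical_extension:
  assumes f: "f \<in> F"
  shows "upset_cut C F I f \<in> pts (canonical_extension C F I)"
proof -
  let ?\<phi> = "\<lambda>g. INF i\<in>I. pairing C g i \<lhd> pairing C f i"
  have "pairing C f i = (INF g\<in>F. ?\<phi> g \<rhd> pairing C g i)" if i: "i \<in> I" for i
  proof (rule order_antisym)
    have "?\<phi> g * pairing C f i \<le> pairing C g i" for g
      unfolding le_lres_iff[symmetric] using i by (rule INF_lower)
    then show "pairing C f i \<le> (INF g\<in>F. ?\<phi> g \<rhd> pairing C g i)"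
      by (simp add: le_INF_iff le_rres_iff)
    let ?b = "INF g\<in>F. ?\<phi> g \<rhd> pairing C g i"
    have "1 \<le> ?\<phi> f"
      by (simp add: le_INF_iff le_lres_iff)
    then have "1 * ?b \<le> ?\<phi> f * ?b"
      by (rule quantale_mult_mono) simp
    also have "\<dots> \<le> pairing C f i"
      unfolding le_rres_iff[symmetric] using f by (rule INF_lower)
    finally show "?b \<le> pairing C f i"
      by simp
  qed
  from this[symmetric] show ?thesis
    by (simp add: canonical_extension_def upset_cut_def)
qed

lemma downset_cut_in_canonical_extension:
  assumes i: "i \<in> I"
  shows "downset_cut C F I i \<in> pts (canonical_extension C F I)"
proof -
  let ?\<psi> = "\<lambda>j. INF f\<in>F. pairing C f i \<rhd> pairing C f j"
  have "pairing C f i = (INF j\<in>I. pairing C f j \<lhd> ?\<psi> j)" if f: "f \<in> F" for f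
  proof (rule order_antisym)
    have "pairing C f i * ?\<psi> j \<le> pairing C f j" for j
      unfolding le_rres_iff[symmetric] using f by (rule INF_lower)
    then show "pairing C f i \<le> (INF j\<in>I. pairing C f j \<lhd> ?\<psi> j)"
      by (simp add: le_INF_iff le_lres_iff)
    let ?a = "INF j\<in>I. pairing C f j \<lhd> ?\<psi> j"
    have "1 \<le> ?\<psi> i"
      by (simp add: le_INF_iff le_rres_iff)
    then have "?a * 1 \<le> ?a * ?\<psi> i"
      by (intro quantale_mult_mono) simp
    also have "\<dots> \<le> pairing C f i"
      unfolding le_lres_iff[symmetric] using i by (rule INF_lower)
    finally show "?a \<le> pairing C f i"
      by simp
  qed
  from this[symmetric] show ?thesis
    by (simp add: canonical_extension_def downset_cut_def)
qed

text \<open>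
  The Yoneda lemma for the cuts named by \<open>F\<close>: written with second components, the hom out of such a
  cut is the right-hand side of the equation defining the first component of \<open>\<kappa>\<close>.
\<close>

lemma hom_upset_cut:
  assumes \<kappa>: "\<kappa> \<in> pts (canonical_extension C F I)" and f: "f \<in> F"
  shows "hom (canonical_extension C F I) (upset_cut C F I f) \<kappa> = fst \<kappa> f"
proof -
  have "fst \<kappa> f = (INF i\<in>I. pairing C f i \<lhd> snd \<kappa> i)"
    using assms by (simp add: canonical_extension_def)
  then show ?thesis
    unfolding hom_canonical_extension_alt[OF upset_cut_in_canonical_extension[OF f] \<kappa>]
    by (simp add: upset_cut_def cong: INF_cong)
qed

lemma hom_downset_cut:
  assumes \<kappa>: "\<kappa> \<in> pts (canonical_extension C F I)" and i: "i \<in> I"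
  shows "hom (canonical_extension C F I) \<kappa> (downset_cut C F I i) = snd \<kappa> i"
proof -
  have "snd \<kappa> i = (INF f\<in>F. fst \<kappa> f \<rhd> pairing C f i)"
    using assms by (simp add: canonical_extension_def)
  then show ?thesis
    unfolding hom_canonical_extension
    by (simp add: downset_cut_def cong: INF_cong)
qed

text \<open>
  An element \<open>x\<close> lies below the hom from \<open>b\<close> to the cut, and equally below the limit formula, iff
  \<open>x * f c * i c \<le> snd b i\<close> for all \<open>c\<close> and \<open>i\<close>: the join in the pairing becomes the meet over \<open>c\<close>.
  The hom in terms of second components is the one in which the pairing with \<open>f\<close> occurs.
\<close>

lemma is_lim_upset_cut:
  assumes emb: "\<And>c. c \<in> pts C \<Longrightarrow> embedding F I c \<in> pts (canonical_extension C F I)"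
    and f: "f \<in> F"
  shows "is_lim (canonical_extension C F I) C f (embedding F I) (upset_cut C F I f)"
proof -
  let ?D = "canonical_extension C F I"
  have "hom ?D b (upset_cut C F I f) = (INF c\<in>pts C. hom ?D b (embedding F I c) \<lhd> f c)"
    if b: "b \<in> pts ?D" for b
  proof -
    have "x \<le> hom ?D b (upset_cut C F I f) \<longleftrightarrow> (\<forall>i\<in>I. x * pairing C f i \<le> snd b i)" for x
      unfolding hom_canonical_extension_alt[OF b upset_cut_in_canonical_extension[OF f]]
      by (simp add: le_INF_iff le_lres_iff upset_cut_def)
    moreover have "x \<le> hom ?D b (embedding F I c) \<lhd> f c \<longleftrightarrow> (\<forall>i\<in>I. x * (f c * i c) \<le> snd b i)"
      if "c \<in> pts C" for x c
      unfolding le_lres_iff[of x] hom_canonical_extension_alt[OF b emb[OF that]]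
      by (simp add: le_INF_iff le_lres_iff embedding_def mult.assoc)
    ultimately have "x \<le> hom ?D b (upset_cut C F I f) \<longleftrightarrow>
        x \<le> (INF c\<in>pts C. hom ?D b (embedding F I c) \<lhd> f c)" for x
      by (auto simp: le_INF_iff mult_pairing_le_iff)
    then show ?thesis
      by (meson order_antisym order_refl)
  qed
  then show ?thesis
    using upset_cut_in_canonical_extension[OF f] by (simp add: is_lim_def)
qed

lemma is_colim_downset_cut:
  assumes i: "i \<in> I"
  shows "is_colim (canonical_extension C F I) C i (embedding F I) (downset_cut C F I i)"
proof -
  let ?D = "canonical_extension C F I"
  have "hom ?D (downset_cut C F I i) b = (INF c\<in>pts C. i c \<rhd> hom ?D (embedding F I c) b)" for b
  proof -
    have "x \<le> hom ?D (downset_cut C F I i) b \<longleftrightarrow> (\<forall>f\<in>F. pairing C f i * x \<le> fst b f)" for x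
      by (simp add: hom_canonical_extension le_INF_iff le_rres_iff downset_cut_def)
    moreover have "x \<le> i c \<rhd> hom ?D (embedding F I c) b \<longleftrightarrow> (\<forall>f\<in>F. f c * i c * x \<le> fst b f)"
      for x c
      by (simp add: hom_canonical_extension le_INF_iff le_rres_iff embedding_def mult.assoc)
    ultimately have "x \<le> hom ?D (downset_cut C F I i) b \<longleftrightarrow>
        x \<le> (INF c\<in>pts C. i c \<rhd> hom ?D (embedding F I c) b)" for x
      by (auto simp: le_INF_iff pairing_mult_le_iff)
    then show ?thesis
      by (meson order_antisym order_refl)
  qed
  then show ?thesis
    using downset_cut_in_canonical_extension[OF i] by (simp add: is_colim_def)
qed

text \<open>
  By the Yoneda lemma, the colimit formula is the definition of the hom by first components, and the
  limit formula below is its expression by second components.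
\<close>

lemma is_colim_upset_cuts:
  assumes "\<kappa> \<in> pts (canonical_extension C F I)"
  shows "is_colim (canonical_extension C F I)
    (induced_space (canonical_extension C F I) F (upset_cut C F I)) (fst \<kappa>) (upset_cut C F I) \<kappa>"
  using assms
  by (simp add: is_colim_def hom_upset_cut hom_canonical_extension[of _ _ _ \<kappa>] cong: INF_cong)

lemma is_lim_downset_cuts:
  assumes "\<kappa> \<in> pts (canonical_extension C F I)"
  shows "is_lim (canonical_extension C F I)
    (induced_space (canonical_extension C F I) I (downset_cut C F I)) (snd \<kappa>) (downset_cut C F I) \<kappa>"
  using assms
  by (simp add: is_lim_def hom_downset_cut hom_canonical_extension_alt[of _ _ _ _ \<kappa>] cong: INF_cong)

theorem theorem4p13:
  fixes C :: "('c, 'q::quantale) qspace"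
    and F I :: "('c \<Rightarrow> 'q) set"
    and \<kappa> :: "('c, 'q) cut"
  assumes "omega_space C"
    and "F \<subseteq> upsets C"
    and "I \<subseteq> downsets C"
    and "\<forall>c\<in>pts C. (\<lambda>x\<in>pts C. hom C c x) \<in> F"
    and "\<forall>c\<in>pts C. (\<lambda>x\<in>pts C. hom C x c) \<in> I"
    and "\<kappa> \<in> pts (canonical_extension C F I)"
  shows "(\<exists>(Y :: ('c \<Rightarrow> 'q, 'q) qspace) H \<phi>.
            omega_space Y \<and>
            omega_functor Y (canonical_extension C F I) H \<and>
            \<phi> \<in> downsets Y \<and>
            is_colim (canonical_extension C F I) Y \<phi> H \<kappa> \<and>
            (\<forall>y\<in>pts Y. \<exists>f\<in>F. is_lim (canonical_extension C F I) C f (embedding F I) (H y))) \<and>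
         (\<exists>(Z :: ('c \<Rightarrow> 'q, 'q) qspace) K \<psi>.
            omega_space Z \<and>
            omega_functor Z (canonical_extension C F I) K \<and>
            \<psi> \<in> upsets Z \<and>
            is_lim (canonical_extension C F I) Z \<psi> K \<kappa> \<and>
            (\<forall>z\<in>pts Z. \<exists>i\<in>I. is_colim (canonical_extension C F I) C i (embedding F I) (K z)))"
proof (intro conjI)
  let ?D = "canonical_extension C F I"
  let ?L = "upset_cut C F I" and ?R = "downset_cut C F I"
  note D = omega_space_canonical_extension[of C F I]
  note \<kappa> = assms(6)
  have ext: "fst \<kappa> \<in> extensional F" "snd \<kappa> \<in> extensional I"
    using \<kappa> by (simp_all add: canonical_extension_def)
  have L: "?L \<in> F \<rightarrow> pts ?D" and R: "?R \<in> I \<rightarrow> pts ?D"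
    by (simp_all add: upset_cut_in_canonical_extension downset_cut_in_canonical_extension)
  have "omega_functor C ?D (embedding F I)"
    using assms by (intro omega_functor_embedding) auto
  then have emb: "embedding F I c \<in> pts ?D" if "c \<in> pts C" for c
    using that by (auto simp: omega_functor_def)
  let ?Y = "induced_space ?D F ?L"
  have "fst \<kappa> \<in> downsets ?Y"
    using D L \<kappa> ext(1) by (rule representable_downset_induced) (simp add: hom_upset_cut[OF \<kappa>])
  moreover have "\<forall>y\<in>pts ?Y. \<exists>f\<in>F. is_lim ?D C f (embedding F I) (?L y)"
    using is_lim_upset_cut[OF emb] by auto
  ultimately show "\<exists>(Y :: ('c \<Rightarrow> 'q, 'q) qspace) H \<phi>.
      omega_space Y \<and> omega_functor Y ?D H \<and> \<phi> \<in> downsets Y \<and> is_colim ?D Y \<phi> H \<kappa> \<and>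
      (\<forall>y\<in>pts Y. \<exists>f\<in>F. is_lim ?D C f (embedding F I) (H y))"
    using omega_space_induced[OF D L] omega_functor_induced[OF L] is_colim_upset_cuts[OF \<kappa>]
    by blast
  let ?Z = "induced_space ?D I ?R"
  have "snd \<kappa> \<in> upsets ?Z"
    using D R \<kappa> ext(2) by (rule representable_upset_induced) (simp add: hom_downset_cut[OF \<kappa>])
  moreover have "\<forall>z\<in>pts ?Z. \<exists>i\<in>I. is_colim ?D C i (embedding F I) (?R z)"
    using is_colim_downset_cut by fastforce
  ultimately show "\<exists>(Z :: ('c \<Rightarrow> 'q, 'q) qspace) K \<psi>.
      omega_space Z \<and> omega_functor Z ?D K \<and> \<psi> \<in> upsets Z \<and> is_lim ?D Z \<psi> K \<kappa> \<and>
      (\<forall>z\<in>pts Z. \<exists>i\<in>I. is_colim ?D C i (embedding F I) (K z))"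
    using omega_space_induced[OF D R] omega_functor_induced[OF R] is_lim_downset_cuts[OF \<kappa>]
    by blast
qed

end
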